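(* Every (finite, simple) graph $G$ with minimum degree at least $3$ has a dominating $K_4$-model.
   Context: A dominating $K_t$-model in a graph $G$ is a sequence $(T_1,\dots,T_t)$ of pairwise disjoint non-empty connected subgraphs of $G$ such that for all $1\le i<j\le t$, every vertex of $T_j$ has a neighbour in $T_i$. *)

theory Defs
  imports "Graph_Theory.Digraph_Component"
begin

(* Finite simple graphs are the symmetric loop-free digraphs without parallel arcs of the
   locale graph: an edge uv is a pair of opposite arcs, so the degree of v is its out-degree
   (the number of its neighbours) and "u is a neighbour of v" is v \<rightarrow>\<^bsub>G\<^esub> u.

   Min {} is unspecified: min_degree is only meaningful if verts G \<noteq> {}. *)

definition min_degree :: "('a, 'b) pre_digraph \<Rightarrow> nat" where
  "min_degree G = Min (out_degree G ` verts G)"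

(* The condition graph H forces a sub-digraph of G to be symmetric, that is, to be a subgraph
   of the undirected graph G. The sequence T_1, ..., T_t is the list Ts, indexed from 0. *)

definition dominating_K_model ::
  "('a, 'b) pre_digraph \<Rightarrow> nat \<Rightarrow> ('a, 'b) pre_digraph list \<Rightarrow> bool" where
  "dominating_K_model G t Ts \<longleftrightarrow>
     length Ts = t \<and>
     (\<forall>H \<in> set Ts. graph H \<and> subgraph H G \<and> verts H \<noteq> {} \<and> connected H) \<and>
     (\<forall>i j. i < j \<and> j < t \<longrightarrow> verts (Ts ! i) \<inter> verts (Ts ! j) = {}) \<and>
     (\<forall>i j. i < j \<and> j < t \<longrightarrow>
        (\<forall>v \<in> verts (Ts ! j). \<exists>u \<in> verts (Ts ! i). v \<rightarrow>\<^bsub>G\<^esub> u))"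

end

theory Submission
  imports Defs
begin

text \<open>
  Call a nonempty vertex set a \<^emph>\<open>core\<close> if each of its vertices has at least two neighbours
  in it; a set contains a core iff it contains a cycle. It suffices to find a connected set
  \<open>D\<close> and a core \<open>H\<close> all of whose vertices have a neighbour in \<open>D\<close>: a core has
  a dominating \<open>K\<^sub>3\<close>-model, to which \<open>D\<close> is prepended.

  Let \<open>G\<close> be connected, without loss of generality, let \<open>D\<close> be a largest connected set
  whose complement \<open>H\<close> contains a core, and let \<open>S\<close> be the set of vertices of \<open>H\<close> with a
  neighbour in \<open>D\<close>. By maximality \<open>H - s\<close> contains no core for any \<open>s \<in> S\<close>, hence \<open>H - s\<close> has
  a vertex \<open>w\<close> of degree at most 1, so of degree at most 2 in \<open>H\<close>, so \<open>w \<in> S\<close>. Then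
  \<open>H - w\<close> is a forest as well, so the degree sum of \<open>H\<close> is at most
  \<open>2 (|H| - 2) + 2 \<cdot> 2 = 2 |H|\<close>. The degrees in \<open>H\<close> are at least 2, and at least 3 outside
  \<open>S\<close>, hence \<open>S = H\<close>, and \<open>H\<close> is a core.
\<close>

context graph
begin

definition deg_in :: "'a set \<Rightarrow> 'a \<Rightarrow> nat" where
  "deg_in A v = card {u \<in> A. v \<rightarrow>\<^bsub>G\<^esub> u}"

definition core :: "'a set \<Rightarrow> bool" where
  "core A \<longleftrightarrow> A \<noteq> {} \<and> (\<forall>v \<in> A. 2 \<le> deg_in A v)"

text \<open>Such an \<open>X\<close> is a union of components of the graph induced on
  \<open>A\<close>. This expresses connectedness without walks and lets components be found by
  minimality.\<close>

definition closed_in :: "'a set \<Rightarrow> 'a set \<Rightarrow> bool" where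
  "closed_in X A \<longleftrightarrow> X \<subseteq> A \<and> (\<forall>v \<in> X. \<forall>u \<in> A. v \<rightarrow>\<^bsub>G\<^esub> u \<longrightarrow> u \<in> X)"

definition connected_set :: "'a set \<Rightarrow> bool" where
  "connected_set A \<longleftrightarrow> A \<noteq> {} \<and> (\<forall>X. closed_in X A \<and> X \<noteq> {} \<longrightarrow> X = A)"

subsection \<open>Connected sets\<close>

lemma connected_set_singleton: "connected_set {v}"
  by (auto simp: connected_set_def closed_in_def)

lemma connected_set_insert:
  assumes "connected_set A" "u \<in> A" "v \<rightarrow>\<^bsub>G\<^esub> u"
  shows "connected_set (insert v A)"
  unfolding connected_set_def
proof (intro conjI allI impI)
  fix X assume X: "closed_in X (insert v A) \<and> X \<noteq> {}"
  have "X \<inter> A \<noteq> {}"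
    using X assms(2,3) by (auto simp: closed_in_def)
  moreover have "closed_in (X \<inter> A) A"
    using X by (auto simp: closed_in_def)
  ultimately have "A \<subseteq> X"
    using assms(1) unfolding connected_set_def by blast
  moreover have "v \<in> X"
    using X calculation assms(2) graph_symmetric[OF assms(3)] by (auto simp: closed_in_def)
  ultimately show "X = insert v A"
    using X by (auto simp: closed_in_def)
qed simp

text \<open>Closedness is transitive, so a nonempty closed set of least size has no proper nonempty
  closed subset.\<close>

lemma exists_component:
  assumes "finite A" "A \<noteq> {}"
  obtains B where "closed_in B A" "connected_set B"
proof -
  have "closed_in A A \<and> A \<noteq> {}"
    using assms by (auto simp: closed_in_def)
  then obtain B where B: "closed_in B A" "B \<noteq> {}"
    and min: "\<And>X. closed_in X A \<Longrightarrow> X \<noteq> {} \<Longrightarrow> card B \<le> card X"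
    using ex_has_least_nat[of "\<lambda>X. closed_in X A \<and> X \<noteq> {}" A card] by blast
  have "X = B" if X: "closed_in X B" "X \<noteq> {}" for X
  proof (rule card_seteq)
    show "finite B"
      using B(1) assms(1) finite_subset[of B A] by (simp add: closed_in_def)
    show "X \<subseteq> B"
      using X by (simp add: closed_in_def)
    have "closed_in X A"
      using X B by (auto simp: closed_in_def)
    then show "card B \<le> card X"
      using X(2) by (rule min)
  qed
  with B have "connected_set B"
    by (auto simp: connected_set_def)
  with B that show ?thesis by blast
qed

lemma exists_boundary:
  assumes "connected_set A" "D \<subset> A" "D \<noteq> {}"
  obtains v u where "v \<in> A - D" "u \<in> D" "v \<rightarrow>\<^bsub>G\<^esub> u"
proof -
  have "\<not> closed_in D A"
    using assms by (auto simp: connected_set_def)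
  with assms(2) obtain u v where "u \<in> D" "v \<in> A - D" "u \<rightarrow>\<^bsub>G\<^esub> v"
    by (auto simp: closed_in_def)
  with that graph_symmetric show ?thesis
    by blast
qed

section \<open>From vertex sets to induced subgraphs\<close>

lemma graph_induce_subgraph:
  assumes "A \<subseteq> verts G"
  shows "graph (G \<restriction> A)"
proof -
  have ind: "induced_subgraph (G \<restriction> A) G"
    using assms by (rule induced_induce)
  interpret H: digraph "G \<restriction> A"
    using ind by (rule digraphI_induced)
  show ?thesis
    using induced_graph_imp_symmetric[OF sym_arcs ind] by (rule H.graphI)
qed

lemma connected_induce_subgraph:
  assumes "A \<subseteq> verts G" "connected_set A"
  shows "connected (G \<restriction> A)"
proof -
  interpret H: graph "G \<restriction> A"
    using assms(1) by (rule graph_induce_subgraph)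
  have "v \<in> {x. u \<rightarrow>\<^sup>*\<^bsub>G \<restriction> A\<^esub> x}" if "u \<in> A" "v \<in> A" for u v
  proof -
    have adj: "x \<rightarrow>\<^bsub>G \<restriction> A\<^esub> y" if "x \<rightarrow>\<^bsub>G\<^esub> y" "x \<in> A" "y \<in> A" for x y
      using that by (auto simp: arcs_ends_conv)
    \<comment> \<open>Being closed and nonempty, the set reachable from \<open>u\<close> must
      exhaust \<open>A\<close>.\<close>
    have "closed_in {x. u \<rightarrow>\<^sup>*\<^bsub>G \<restriction> A\<^esub> x} A"
      unfolding closed_in_def
    proof (intro conjI ballI impI subsetI; unfold mem_Collect_eq)
      fix x assume x: "u \<rightarrow>\<^sup>*\<^bsub>G \<restriction> A\<^esub> x"
      from H.reachable_in_verts(2)[OF x] show xA: "x \<in> A"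
        by simp
      fix y assume y: "y \<in> A" "x \<rightarrow>\<^bsub>G\<^esub> y"
      show "u \<rightarrow>\<^sup>*\<^bsub>G \<restriction> A\<^esub> y"
        by (rule H.reachable_adj_trans[OF x adj[OF y(2) xA y(1)]])
    qed
    moreover have "u \<in> {x. u \<rightarrow>\<^sup>*\<^bsub>G \<restriction> A\<^esub> x}"
      using that by simp
    ultimately show ?thesis
      using assms(2) that unfolding connected_set_def by blast
  qed
  then show ?thesis
    using assms(2) H.reachable_mk_symmetricI
    by (intro H.connectedI) (auto simp: connected_set_def)
qed

subsection \<open>Degrees and cores\<close>

lemma deg_in_mono: "finite B \<Longrightarrow> A \<subseteq> B \<Longrightarrow> deg_in A v \<le> deg_in B v"
  unfolding deg_in_def by (rule card_mono) auto

lemma deg_in_closed_in: "closed_in B A \<Longrightarrow> v \<in> B \<Longrightarrow> deg_in B v = deg_in A v"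
  unfolding deg_in_def closed_in_def by (rule arg_cong[of _ _ card]) auto

lemma deg_in_remove:
  assumes "finite A" "w \<in> A"
  shows "deg_in A v = deg_in (A - {w}) v + (if v \<rightarrow>\<^bsub>G\<^esub> w then 1 else 0)"
proof (cases "v \<rightarrow>\<^bsub>G\<^esub> w")
  case True
  then have "{u \<in> A. v \<rightarrow>\<^bsub>G\<^esub> u} = insert w {u \<in> A - {w}. v \<rightarrow>\<^bsub>G\<^esub> u}"
    using assms by auto
  with True show ?thesis
    using assms by (simp add: deg_in_def)
next
  case False
  then have "{u \<in> A. v \<rightarrow>\<^bsub>G\<^esub> u} = {u \<in> A - {w}. v \<rightarrow>\<^bsub>G\<^esub> u}"
    by auto
  with False show ?thesis
    by (simp add: deg_in_def)
qed

lemma deg_in_self: "deg_in (A - {v}) v = deg_in A v"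
  unfolding deg_in_def by (rule arg_cong[of _ _ card]) (use adj_not_same in auto)

lemma exists_neighbour:
  assumes "2 \<le> deg_in A v"
  obtains u where "u \<in> A" "v \<rightarrow>\<^bsub>G\<^esub> u" "u \<noteq> x"
proof -
  have "\<not> {u \<in> A. v \<rightarrow>\<^bsub>G\<^esub> u} \<subseteq> {x}"
  proof
    assume "{u \<in> A. v \<rightarrow>\<^bsub>G\<^esub> u} \<subseteq> {x}"
    from card_mono[OF _ this] show False
      using assms by (simp add: deg_in_def)
  qed
  with that show ?thesis by auto
qed

text \<open>Each edge at \<open>w\<close> is counted once at \<open>w\<close> and, by symmetry, once
  at its other end; hence the factor 2.\<close>

lemma sum_deg_in_remove:
  assumes "finite A" "w \<in> A"
  shows "sum (deg_in A) A = 2 * deg_in A w + sum (deg_in (A - {w})) (A - {w})"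
proof -
  have "{v \<in> A - {w}. v \<rightarrow>\<^bsub>G\<^esub> w} = {v \<in> A - {w}. w \<rightarrow>\<^bsub>G\<^esub> v}"
    using graph_symmetric by auto
  then have "(\<Sum>v \<in> A - {w}. if v \<rightarrow>\<^bsub>G\<^esub> w then 1 else 0) = deg_in A w"
    using assms(1) by (subst deg_in_self[of A w, symmetric]) (simp add: deg_in_def sum.If_cases Int_def)
  moreover have "sum (deg_in A) (A - {w}) =
      sum (deg_in (A - {w})) (A - {w}) + (\<Sum>v \<in> A - {w}. if v \<rightarrow>\<^bsub>G\<^esub> w then 1 else 0)"
    unfolding sum.distrib[symmetric] by (rule sum.cong[OF refl deg_in_remove[OF assms]])
  ultimately show ?thesis
    using sum.remove[OF assms, of "deg_in A"] by simp
qed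

text \<open>Without a core the set induces a forest, which has fewer edges than vertices. As
  \<open>A\<close> itself is no core, it has a vertex of degree at most 1, whose deletion lowers the
  sum by at most 2.\<close>

lemma sum_deg_in_forest:
  assumes "finite A" "A \<noteq> {}" "\<And>B. B \<subseteq> A \<Longrightarrow> \<not> core B"
  shows "sum (deg_in A) A + 2 \<le> 2 * card A"
  using assms
proof (induction A rule: finite_psubset_induct)
  case (psubset A)
  then obtain w where w: "w \<in> A" "deg_in A w \<le> 1"
    using psubset.prems(2)[of A] by (force simp: core_def not_le)
  have card: "card A = Suc (card (A - {w}))"
    by (rule card.remove[OF psubset.hyps w(1)])
  show ?case
  proof (cases "A = {w}")
    case True
    then show ?thesis
      using adj_not_same[of w] by (auto simp: deg_in_def)
  next
    case False
    have "sum (deg_in (A - {w})) (A - {w}) + 2 \<le> 2 * card (A - {w})"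
      using w(1) False psubset.prems by (intro psubset.IH) auto
    then show ?thesis
      using w(2) sum_deg_in_remove[OF psubset.hyps w(1)] card by simp
  qed
qed

subsection \<open>Dominated cores\<close>

text \<open>Extremal choice: within a component \<open>B\<close> of the core, take a largest
  connected \<open>T\<close> such that \<open>B - T\<close> still spans an edge. Maximality forces
  both ends of that edge to see \<open>T\<close>.\<close>

lemma core_imp_K3_model:
  assumes "finite A" "core A"
  obtains T x y where "connected_set T" "T \<subseteq> A" "x \<in> A - T" "y \<in> A - T" "x \<rightarrow>\<^bsub>G\<^esub> y"
    "\<exists>u \<in> T. x \<rightarrow>\<^bsub>G\<^esub> u" "\<exists>u \<in> T. y \<rightarrow>\<^bsub>G\<^esub> u"
proof -
  obtain B where B: "closed_in B A" "connected_set B"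
    using assms exists_component by (auto simp: core_def)
  have sub: "B \<subseteq> A" and fin: "finite B"
    using B assms(1) by (auto simp: closed_in_def intro: finite_subset)
  have deg: "2 \<le> deg_in B v" if "v \<in> B" for v
    using that assms(2) B(1) sub by (auto simp: core_def deg_in_closed_in)
  define P where "P T \<longleftrightarrow> connected_set T \<and> T \<subseteq> B \<and>
    (\<exists>x \<in> B - T. \<exists>y \<in> B - T. x \<rightarrow>\<^bsub>G\<^esub> y)" for T
  have "\<exists>T. P T"
  \<comment> \<open>Three distinct vertices \<open>x\<close>, \<open>y\<close>, \<open>z\<close> in
    a row: the singleton of \<open>z\<close> leaves the edge from \<open>x\<close> to
    \<open>y\<close>.\<close>
  proof -
    obtain x where x: "x \<in> B"
      using B(2) by (auto simp: connected_set_def)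
    obtain y where y: "y \<in> B" "x \<rightarrow>\<^bsub>G\<^esub> y"
      using exists_neighbour[OF deg[OF x]] by metis
    obtain z where z: "z \<in> B" "y \<rightarrow>\<^bsub>G\<^esub> z" "z \<noteq> x"
      using exists_neighbour[OF deg[OF y(1)]] by metis
    have "z \<noteq> y"
      using z(2) adj_not_same by auto
    then have "P {z}"
      using x y z connected_set_singleton by (auto simp: P_def)
    then show ?thesis ..
  qed
  moreover have "card T < Suc (card B)" if "P T" for T
    using that fin by (auto simp: P_def less_Suc_eq_le intro: card_mono)
  ultimately obtain T where "P T" and max: "\<And>T'. P T' \<Longrightarrow> card T' \<le> card T"
    using ex_has_greatest_nat[of P _ card "Suc (card B)"] by metis
  then obtain x y where T: "connected_set T" "T \<subseteq> B" "x \<in> B - T" "y \<in> B - T" "x \<rightarrow>\<^bsub>G\<^esub> y"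
    unfolding P_def by blast
  \<comment> \<open>An edge avoiding \<open>v\<close> would survive moving \<open>v\<close> into
    \<open>T\<close>, against maximality.\<close>
  have no_edge: "a = v \<or> b = v"
    if v: "v \<in> B - T" "u \<in> T" "v \<rightarrow>\<^bsub>G\<^esub> u" and ab: "a \<in> B - T" "b \<in> B - T" "a \<rightarrow>\<^bsub>G\<^esub> b" for v u a b
  proof (rule ccontr)
    assume "\<not> (a = v \<or> b = v)"
    moreover have "connected_set (insert v T)"
      using connected_set_insert[OF T(1) v(2,3)] .
    ultimately have "P (insert v T)"
      using v ab T(2) unfolding P_def by blast
    from max[OF this] show False
      using v(1) T(2) fin finite_subset[of T B] by simp
  qed
  have both: "\<exists>u \<in> T. b \<rightarrow>\<^bsub>G\<^esub> u"
    if "a \<in> B - T" "u \<in> T" "a \<rightarrow>\<^bsub>G\<^esub> u" and b: "b \<in> B - T" "a \<rightarrow>\<^bsub>G\<^esub> b" for a b u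
  proof -
    \<comment> \<open>If \<open>z\<close> were outside \<open>T\<close>, the edge from
      \<open>b\<close> to \<open>z\<close> would avoid \<open>a\<close>, contrary to
      \<open>no_edge\<close>.\<close>
    obtain z where z: "z \<in> B" "b \<rightarrow>\<^bsub>G\<^esub> z" "z \<noteq> a"
      using exists_neighbour[OF deg, of b] b(1) by blast
    have "b \<noteq> a"
      using b(2) adj_not_same by auto
    then show ?thesis
      using no_edge[OF that(1-3) b(1), of z] z by auto
  qed
  obtain v u where v: "v \<in> B - T" "u \<in> T" "v \<rightarrow>\<^bsub>G\<^esub> u"
    using exists_boundary[OF B(2), of T] T by (auto simp: connected_set_def)
  have "x = v \<or> y = v"
    using no_edge[OF v T(3-5)] .
  then have "(\<exists>u \<in> T. x \<rightarrow>\<^bsub>G\<^esub> u) \<and> (\<exists>u \<in> T. y \<rightarrow>\<^bsub>G\<^esub> u)"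
    using v both[OF v] T(3-5) graph_symmetric by blast
  then show ?thesis
    using that[of T x y] T sub by blast
qed

lemma exists_dominated_core:
  assumes "finite V" "V \<noteq> {}" "\<And>v. v \<in> V \<Longrightarrow> 3 \<le> deg_in V v"
  obtains D H where "connected_set D" "D \<subseteq> V" "core H" "H \<subseteq> V - D"
    "\<And>v. v \<in> H \<Longrightarrow> \<exists>u \<in> D. v \<rightarrow>\<^bsub>G\<^esub> u"
proof -
  \<comment> \<open>Degrees in the closed set \<open>W\<close> agree with those in \<open>V\<close>,
    so \<open>W\<close> can serve as the connected graph of the outline.\<close>
  obtain W where W: "closed_in W V" "connected_set W"
    using assms exists_component by blast
  have sub: "W \<subseteq> V" and fin: "finite W"
    using W assms(1) by (auto simp: closed_in_def intro: finite_subset)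
  have deg: "3 \<le> deg_in W v" if "v \<in> W" for v
    using that assms(3) W(1) sub by (auto simp: deg_in_closed_in)
  define P where "P D \<longleftrightarrow> connected_set D \<and> D \<subseteq> W \<and> (\<exists>A \<subseteq> W - D. core A)" for D
  have "\<exists>D. P D"
  proof -
    obtain v where v: "v \<in> W"
      using W(2) by (auto simp: connected_set_def)
    have "2 \<le> deg_in W v"
      using deg[OF v] by simp
    then obtain u where "u \<in> W" "v \<rightarrow>\<^bsub>G\<^esub> u"
      by (rule exists_neighbour)
    then have "W - {v} \<noteq> {}"
      using adj_not_same by auto
    \<comment> \<open>Deleting one vertex lowers each degree by at most 1, so a singleton is an
      admissible start for the extremal choice.\<close>
    moreover have "2 \<le> deg_in (W - {v}) x" if "x \<in> W - {v}" for x
      using deg[of x] deg_in_remove[OF fin v, of x] that by (auto split: if_splits)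
    ultimately have "core (W - {v})"
      by (auto simp: core_def)
    then have "P {v}"
      using v connected_set_singleton by (auto simp: P_def)
    then show ?thesis ..
  qed
  moreover have "card D < Suc (card W)" if "P D" for D
    using that fin by (auto simp: P_def less_Suc_eq_le intro: card_mono)
  ultimately obtain D where "P D" and max: "\<And>D'. P D' \<Longrightarrow> card D' \<le> card D"
    using ex_has_greatest_nat[of P _ card "Suc (card W)"] by metis
  then obtain A where D: "connected_set D" "D \<subseteq> W" and A: "A \<subseteq> W - D" "core A"
    unfolding P_def by blast
  define H where "H = W - D"
  define S where "S = {v \<in> H. \<exists>u \<in> D. v \<rightarrow>\<^bsub>G\<^esub> u}"
  have finH: "finite H"
    using fin by (simp add: H_def)
  have no_core: "\<not> core B" if s: "s \<in> S" and B: "B \<subseteq> H - {s}" for s B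
  proof
    assume "core B"
    moreover have "connected_set (insert s D)"
      using s connected_set_insert[OF D(1)] by (auto simp: S_def)
    moreover have "insert s D \<subseteq> W" "B \<subseteq> W - insert s D"
      using s B D(2) by (auto simp: S_def H_def)
    ultimately have "P (insert s D)"
      unfolding P_def by blast
    from max[OF this] show False
      using s D(2) fin finite_subset[of D W] by (simp add: S_def H_def)
  qed
  have deg3: "3 \<le> deg_in H v" if "v \<in> H - S" for v
  proof -
    \<comment> \<open>Outside \<open>S\<close> there is no neighbour in \<open>D\<close>, so no
      degree is lost in passing from \<open>W\<close> to \<open>H\<close>.\<close>
    have "{u \<in> H. v \<rightarrow>\<^bsub>G\<^esub> u} = {u \<in> W. v \<rightarrow>\<^bsub>G\<^esub> u}"
      using that by (auto simp: S_def H_def)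
    then show ?thesis
      using deg[of v] that by (simp add: deg_in_def H_def)
  qed
  have deg2: "2 \<le> deg_in H v" if "v \<in> H" for v
  proof (cases "v \<in> S")
    case True
    \<comment> \<open>By \<open>no_core\<close>, every core inside \<open>H\<close> contains all of
      \<open>S\<close>.\<close>
    then have "v \<in> A"
      using no_core[of v A] A by (auto simp: H_def)
    then have "2 \<le> deg_in A v"
      using A(2) by (auto simp: core_def)
    also have "\<dots> \<le> deg_in H v"
      using A(1) finH by (intro deg_in_mono) (auto simp: H_def)
    finally show ?thesis .
  next
    case False
    then show ?thesis
      using deg3[of v] that by simp
  qed
  have "A \<noteq> {}"
    using A(2) by (simp add: core_def)
  with A(1) have "H \<noteq> {}"
    by (auto simp: H_def)
  then have coreH: "core H"
    using deg2 by (auto simp: core_def)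
  have "D \<subset> W" "D \<noteq> {}"
    using D \<open>H \<noteq> {}\<close> by (auto simp: H_def connected_set_def)
  then obtain s u where "s \<in> W - D" "u \<in> D" "s \<rightarrow>\<^bsub>G\<^esub> u"
    by (rule exists_boundary[OF W(2)])
  then have s: "s \<in> S"
    by (auto simp: S_def H_def)
  have nonempty: "H - {v} \<noteq> {}" if "v \<in> H" for v
    using exists_neighbour[OF deg2[OF that], of v] by auto
  obtain w where w: "w \<in> H - {s}" "deg_in (H - {s}) w \<le> 1"
    using no_core[OF s, of "H - {s}"] nonempty[of s] s
    by (force simp: core_def S_def not_le)
  have "s \<in> H"
    using s by (simp add: S_def)
  \<comment> \<open>Passing from \<open>H - {s}\<close> to \<open>H\<close> adds at most the edge to
    \<open>s\<close>.\<close>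
  then have degw: "deg_in H w \<le> 2"
    using deg_in_remove[OF finH, of s w] w(2) by (simp split: if_splits)
  then have wS: "w \<in> S"
    using deg3[of w] w(1) by force
  \<comment> \<open>The forest bound for \<open>H - {w}\<close> gives at most
    \<open>2 * card H - 4\<close>; restoring \<open>w\<close> adds at most 4.\<close>
  have "sum (deg_in (H - {w})) (H - {w}) + 2 \<le> 2 * card (H - {w})"
    using no_core[OF wS] nonempty[of w] w(1) finH by (intro sum_deg_in_forest) auto
  moreover have "card H = Suc (card (H - {w}))"
    using w(1) finH by (intro card.remove) auto
  moreover have "sum (deg_in H) H = 2 * deg_in H w + sum (deg_in (H - {w})) (H - {w})"
    using w(1) finH by (intro sum_deg_in_remove) auto
  ultimately have sum_le: "sum (deg_in H) H \<le> 2 * card H"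
    using degw by linarith
  have "v \<in> S" if v: "v \<in> H" for v
  proof (rule ccontr)
    assume "v \<notin> S"
    then have "2 < deg_in H v"
      using deg3[of v] v by simp
    \<comment> \<open>All degrees in \<open>H\<close> are at least 2, so one degree above 2 already
      makes the sum exceed \<open>2 * card H\<close>.\<close>
    then have "(\<Sum>v \<in> H. 2) < sum (deg_in H) H"
      using sum_strict_mono_ex1[OF finH, of "\<lambda>_. 2" "deg_in H"] deg2 v by blast
    with sum_le show False by simp
  qed
  then show ?thesis
    using that[of D H] D coreH sub by (auto simp: S_def H_def)
qed

section \<open>Assembling the dominating model\<close>

lemma deg_in_verts: "deg_in (verts G) v = out_degree G v"
proof -
  have "{u \<in> verts G. v \<rightarrow>\<^bsub>G\<^esub> u} = head G ` out_arcs G v"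
    by (auto simp: arcs_ends_conv)
  \<comment> \<open>Without parallel arcs, an outgoing arc is determined by its head.\<close>
  moreover have "inj_on (head G) (out_arcs G v)"
    by (auto intro!: inj_onI no_multi_arcs simp: arc_to_ends_def)
  ultimately show ?thesis
    by (simp add: deg_in_def out_degree_def card_image)
qed

end

theorem theorem7:
  fixes G :: "('a, 'b) pre_digraph"
  assumes "graph G"
    and "verts G \<noteq> {}"
    and "min_degree G \<ge> 3"
  shows "\<exists>Ts. dominating_K_model G 4 Ts"
proof -
  interpret graph G by fact
  have "3 \<le> deg_in (verts G) v" if "v \<in> verts G" for v
    using assms(3) that by (auto simp: deg_in_verts min_degree_def intro: order_trans)
  then obtain D H where D: "connected_set D" "D \<subseteq> verts G"
    and H: "core H" "H \<subseteq> verts G - D" "\<And>v. v \<in> H \<Longrightarrow> \<exists>u \<in> D. v \<rightarrow>\<^bsub>G\<^esub> u"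
    using exists_dominated_core[OF finite_verts assms(2)] by metis
  have "finite H"
    using H(2) by (auto intro: finite_subset[OF _ finite_verts])
  then obtain T x y where T: "connected_set T" "T \<subseteq> H" "x \<in> H - T" "y \<in> H - T" "x \<rightarrow>\<^bsub>G\<^esub> y"
    "\<exists>u \<in> T. x \<rightarrow>\<^bsub>G\<^esub> u" "\<exists>u \<in> T. y \<rightarrow>\<^bsub>G\<^esub> u"
    using core_imp_K3_model[OF _ H(1)] by metis
  have "y \<rightarrow>\<^bsub>G\<^esub> x" "x \<noteq> y"
    using T(5) graph_symmetric adj_not_same by auto
  \<comment> \<open>\<open>D\<close> comes first because it dominates all of \<open>H\<close>, which
    contains the other three sets; \<open>T\<close> dominates \<open>x\<close> and \<open>y\<close>,
    and the arc from \<open>y\<close> to \<open>x\<close> settles the last pair.\<close>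
  define Xs where "Xs = [D, T, {x}, {y}]"
  have Xs: "X \<subseteq> verts G \<and> connected_set X" if "X \<in> set Xs" for X
    using that D H(2) T connected_set_singleton by (auto simp: Xs_def)
  have pairs: "(i, j) \<in> {(0,1), (0,2), (0,3), (1,2), (1,3), (2,3)}" if "i < j \<and> j < 4" for i j :: nat
    using that by auto
  have "dominating_K_model G 4 (map ((\<restriction>) G) Xs)"
    unfolding dominating_K_model_def
  proof (intro conjI ballI allI impI)
    show "length (map ((\<restriction>) G) Xs) = 4"
      by (simp add: Xs_def)
  next
    fix K assume "K \<in> set (map ((\<restriction>) G) Xs)"
    then obtain X where K: "K = G \<restriction> X" "X \<subseteq> verts G" "connected_set X"
      using Xs by auto
    show "graph K" "subgraph K G" "connected K"
      using K graph_induce_subgraph subgraph_induce_subgraphI connected_induce_subgraph by auto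
    show "verts K \<noteq> {}"
      using K by (simp add: connected_set_def)
  next
    fix i j assume ij: "i < j \<and> j < (4::nat)"
    show "verts (map ((\<restriction>) G) Xs ! i) \<inter> verts (map ((\<restriction>) G) Xs ! j) = {}"
      using pairs[OF ij] T(2-4) H(2) \<open>x \<noteq> y\<close> by (fastforce simp: Xs_def)
  next
    fix i j v assume ij: "i < j \<and> j < (4::nat)" and v: "v \<in> verts (map ((\<restriction>) G) Xs ! j)"
    show "\<exists>u \<in> verts (map ((\<restriction>) G) Xs ! i). v \<rightarrow>\<^bsub>G\<^esub> u"
      using pairs[OF ij] v T H(3) \<open>y \<rightarrow>\<^bsub>G\<^esub> x\<close> by (auto simp: Xs_def)
  qed
  then show ?thesis ..
qed

end
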